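(* Let $(X,\odot,\ell,r)$ be an $\ell r$-multimagma, and for $A\subseteq X$ put $\textit{dom}(A)=\ell(A)=\{\ell(a)\mid a\in A\}$ and $\textit{cod}(A)=r(A)=\{r(a)\mid a\in A\}$. \begin{enumerate} \item Then $(\mathcal{P}X,\subseteq,\odot,E,\textit{dom},\textit{cod})$ is a boolean modal prequantale whose complete boolean algebra is atomic. \item If $X$ is an $\ell r$-multisemigroup, it is a weakly local modal quantale. \item If $X$ is a local $\ell r$-multisemigroup, it is a modal quantale. \end{enumerate}
   Context: A multimagma is a non-empty set $X$ with $\odot:X\times X\to\mathcal{P}X$; extended to subsets by $A\odot B=\bigcup\{a\odot b\mid a\in A,b\in B\}$; $D_{xy}$ means $x\odot y\neq\emptyset$. An $\ell r$-multimagma is a multimagma with $\ell,r:X\to X$ such that $D_{xy}\Rightarrow r(x)=\ell(y)$, $\ell(x)\odot x=\{x\}$, $x\odot r(x)=\{x\}$ for all $x,y$. An $\ell r$-multisemigroup additionally satisfies $x\odot(y\odot z)=(x\odot y)\odot z$; it is local if $r(x)=\ell(y)\Rightarrow D_{xy}$. $E=\{x\in X\mid\ell(x)=x\}$. A prequantale $(Q,\le,\cdot,1)$ is a complete lattice with a binary operation $\cdot$ with two-sided unit $1$ preserving all sups in each argument; $\bot$ least element. A modal prequantale: prequantale with $\textit{dom},\textit{cod}:Q\to Q$ such that $\alpha\le\textit{dom}(\alpha)\cdot\alpha$, $\textit{dom}(\textit{dom}(\alpha)\cdot\beta)=\textit{dom}(\alpha)\cdot\textit{dom}(\beta)$, $\textit{dom}(\alpha)\le1$,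 $\textit{dom}(\bot)=\bot$, $\textit{dom}(\alpha\vee\beta)=\textit{dom}(\alpha)\vee\textit{dom}(\beta)$, the opposite axioms for $\textit{cod}$ (arguments of $\cdot$ swapped), and $\textit{dom}\circ\textit{cod}=\textit{cod}$, $\textit{cod}\circ\textit{dom}=\textit{dom}$. It is boolean if its lattice is a complete boolean algebra. A weakly local modal quantale is a modal prequantale with associative $\cdot$. A modal quantale is a prequantale with associative $\cdot$ and $\textit{dom},\textit{cod}$ satisfying the same axioms with the export axioms replaced by $\textit{dom}(\alpha\cdot\textit{dom}(\beta))=\textit{dom}(\alpha\cdot\beta)$ and $\textit{cod}(\textit{cod}(\alpha)\cdot\beta)=\textit{cod}(\alpha\cdot\beta)$. *)

theory Defs
  imports "HOL-Algebra.Complete_Lattice"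
begin

section \<open>Multimagmas and multisemigroups with source and target maps\<close>

definition set_ext :: "('a \<Rightarrow> 'a \<Rightarrow> 'a set) \<Rightarrow> 'a set \<Rightarrow> 'a set \<Rightarrow> 'a set" where
  "set_ext m A B = \<Union>{m a b | a b. a \<in> A \<and> b \<in> B}"

locale multimagma =
  fixes X :: "'a set"
    and m :: "'a \<Rightarrow> 'a \<Rightarrow> 'a set" (infixl \<open>\<odot>\<close> 70)
  assumes nonempty: "X \<noteq> {}"
    and mult_closed: "\<lbrakk>x \<in> X; y \<in> X\<rbrakk> \<Longrightarrow> x \<odot> y \<subseteq> X"
begin

definition D :: "'a \<Rightarrow> 'a \<Rightarrow> bool" where
  "D x y \<longleftrightarrow> x \<odot> y \<noteq> {}"

end

locale lr_multimagma = multimagma X m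
  for X :: "'a set" and m :: "'a \<Rightarrow> 'a \<Rightarrow> 'a set" (infixl \<open>\<odot>\<close> 70) +
  fixes l r :: "'a \<Rightarrow> 'a"
  assumes l_closed: "x \<in> X \<Longrightarrow> l x \<in> X"
    and r_closed: "x \<in> X \<Longrightarrow> r x \<in> X"
    and D_imp: "\<lbrakk>x \<in> X; y \<in> X; D x y\<rbrakk> \<Longrightarrow> r x = l y"
    and l_absorb: "x \<in> X \<Longrightarrow> l x \<odot> x = {x}"
    and r_absorb: "x \<in> X \<Longrightarrow> x \<odot> r x = {x}"

locale lr_multisemigroup = lr_multimagma +
  assumes assoc: "\<lbrakk>x \<in> X; y \<in> X; z \<in> X\<rbrakk>
    \<Longrightarrow> set_ext m {x} (m y z) = set_ext m (m x y) {z}"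

locale local_lr_multisemigroup = lr_multisemigroup +
  assumes locality: "\<lbrakk>x \<in> X; y \<in> X; r x = l y\<rbrakk> \<Longrightarrow> D x y"

definition unit_set :: "'a set \<Rightarrow> ('a \<Rightarrow> 'a) \<Rightarrow> 'a set" where
  "unit_set X l = {x \<in> X. l x = x}"

section \<open>Modal prequantales and quantales\<close>

locale prequantale = complete_lattice L for L (structure) +
  fixes mult :: "'a \<Rightarrow> 'a \<Rightarrow> 'a" (infixl \<open>\<cdot>\<close> 75)
    and unit :: 'a
  assumes mult_closed: "\<lbrakk>a \<in> carrier L; b \<in> carrier L\<rbrakk> \<Longrightarrow> a \<cdot> b \<in> carrier L"
    and unit_closed: "unit \<in> carrier L"
    and unit_left: "a \<in> carrier L \<Longrightarrow> unit \<cdot> a = a"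
    and unit_right: "a \<in> carrier L \<Longrightarrow> a \<cdot> unit = a"
    and mult_Sup_right: "\<lbrakk>a \<in> carrier L; B \<subseteq> carrier L\<rbrakk>
      \<Longrightarrow> a \<cdot> (\<Squnion>B) = \<Squnion>((\<lambda>b. a \<cdot> b) ` B)"
    and mult_Sup_left: "\<lbrakk>A \<subseteq> carrier L; b \<in> carrier L\<rbrakk>
      \<Longrightarrow> (\<Squnion>A) \<cdot> b = \<Squnion>((\<lambda>a. a \<cdot> b) ` A)"

text \<open>The axioms common to modal prequantales and modal quantales, i.e. all but
  export and locality.\<close>

locale pre_modal = prequantale L mult unit
  for L (structure) and mult :: "'a \<Rightarrow> 'a \<Rightarrow> 'a" (infixl \<open>\<cdot>\<close> 75) and unit :: 'a +
  fixes dom cod :: "'a \<Rightarrow> 'a"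
  assumes dom_closed: "a \<in> carrier L \<Longrightarrow> dom a \<in> carrier L"
    and cod_closed: "a \<in> carrier L \<Longrightarrow> cod a \<in> carrier L"
    and dom_absorb: "a \<in> carrier L \<Longrightarrow> a \<sqsubseteq> dom a \<cdot> a"
    and dom_le_unit: "a \<in> carrier L \<Longrightarrow> dom a \<sqsubseteq> unit"
    and dom_bottom: "dom \<bottom> = \<bottom>"
    and dom_join: "\<lbrakk>a \<in> carrier L; b \<in> carrier L\<rbrakk> \<Longrightarrow> dom (a \<squnion> b) = dom a \<squnion> dom b"
    and cod_absorb: "a \<in> carrier L \<Longrightarrow> a \<sqsubseteq> a \<cdot> cod a"
    and cod_le_unit: "a \<in> carrier L \<Longrightarrow> cod a \<sqsubseteq> unit"
    and cod_bottom: "cod \<bottom> = \<bottom>"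
    and cod_join: "\<lbrakk>a \<in> carrier L; b \<in> carrier L\<rbrakk> \<Longrightarrow> cod (a \<squnion> b) = cod a \<squnion> cod b"
    and dom_cod: "a \<in> carrier L \<Longrightarrow> dom (cod a) = cod a"
    and cod_dom: "a \<in> carrier L \<Longrightarrow> cod (dom a) = dom a"

locale modal_prequantale = pre_modal +
  assumes dom_export: "\<lbrakk>a \<in> carrier L; b \<in> carrier L\<rbrakk>
      \<Longrightarrow> dom (mult (dom a) b) = mult (dom a) (dom b)"
    and cod_export: "\<lbrakk>a \<in> carrier L; b \<in> carrier L\<rbrakk>
      \<Longrightarrow> cod (mult a (cod b)) = mult (cod a) (cod b)"

locale complete_boolean_algebra = complete_lattice L for L (structure) +
  assumes distrib: "\<lbrakk>x \<in> carrier L; y \<in> carrier L; z \<in> carrier L\<rbrakk>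
      \<Longrightarrow> x \<sqinter> (y \<squnion> z) = (x \<sqinter> y) \<squnion> (x \<sqinter> z)"
    and complemented: "x \<in> carrier L \<Longrightarrow> \<exists>y \<in> carrier L. x \<squnion> y = \<top> \<and> x \<sqinter> y = \<bottom>"

locale boolean_modal_prequantale =
  modal_prequantale L mult unit dom cod + complete_boolean_algebra L
  for L (structure) and mult unit dom cod

definition is_atom :: "('a, 'b) gorder_scheme \<Rightarrow> 'a \<Rightarrow> bool" where
  "is_atom L a \<longleftrightarrow> a \<in> carrier L \<and> a \<noteq> \<bottom>\<^bsub>L\<^esub> \<and>
     (\<forall>b \<in> carrier L. b \<sqsubseteq>\<^bsub>L\<^esub> a \<longrightarrow> b = \<bottom>\<^bsub>L\<^esub> \<or> b = a)"

definition atomic :: "('a, 'b) gorder_scheme \<Rightarrow> bool" where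
  "atomic L \<longleftrightarrow> (\<forall>x \<in> carrier L. x \<noteq> \<bottom>\<^bsub>L\<^esub> \<longrightarrow> (\<exists>a. is_atom L a \<and> a \<sqsubseteq>\<^bsub>L\<^esub> x))"

locale weakly_local_modal_quantale = modal_prequantale +
  assumes mult_assoc: "\<lbrakk>a \<in> carrier L; b \<in> carrier L; c \<in> carrier L\<rbrakk>
      \<Longrightarrow> mult (mult a b) c = mult a (mult b c)"

locale modal_quantale = pre_modal +
  assumes mult_assoc: "\<lbrakk>a \<in> carrier L; b \<in> carrier L; c \<in> carrier L\<rbrakk>
      \<Longrightarrow> mult (mult a b) c = mult a (mult b c)"
    and dom_local: "\<lbrakk>a \<in> carrier L; b \<in> carrier L\<rbrakk>
      \<Longrightarrow> dom (mult a (dom b)) = dom (mult a b)"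
    and cod_local: "\<lbrakk>a \<in> carrier L; b \<in> carrier L\<rbrakk>
      \<Longrightarrow> cod (mult (cod a) b) = cod (mult a b)"

section \<open>The powerset order\<close>

definition powerset_order :: "'a set \<Rightarrow> 'a set gorder" where
  "powerset_order X = \<lparr>carrier = Pow X, eq = (=), le = (\<subseteq>)\<rparr>"

end

theory Submission
  imports Defs
begin

text \<open>Whether a composite with a unit is defined is decided by \<^term>\<open>l\<close> and \<^term>\<open>r\<close>
  alone: if \<open>l y \<odot> x\<close> is non-empty then \<open>l y = l x\<close>, so it equals \<open>{x}\<close>. This makes the subset
  of units act as an identity and gives the export axioms. In a multisemigroup, associativity
  applied to \<open>l x \<odot> (x \<odot> y)\<close> shows that \<^term>\<open>l\<close> is constant with value \<open>l x\<close> on \<open>x \<odot> y\<close>;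
  hence \<open>l (A \<odot> B)\<close> only depends on which pairs are composable, and locality says that
  this in turn only depends on \<open>l B\<close>.\<close>

section \<open>The powerset as a complete atomic boolean algebra\<close>

lemma powerset_order_simps [simp]:
  "carrier (powerset_order X) = Pow X"
  "le (powerset_order X) = (\<subseteq>)"
  "eq (powerset_order X) = (=)"
  by (simp_all add: powerset_order_def)

lemma partial_order_powerset: "partial_order (powerset_order X)"
  by unfold_locales auto

lemma is_lub_powerset:
  assumes "S \<subseteq> Pow X"
  shows "is_lub (powerset_order X) (\<Union>S) S"
  using assms by (fastforce simp: least_def Upper_def)

text \<open>Intersecting with \<open>X\<close> handles the empty family: there
  \<open>\<Inter>S\<close> is the whole type, while the greatest lower bound is the top element
  \<open>X\<close>.\<close>

lemma is_glb_powerset: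
  assumes "S \<subseteq> Pow X"
  shows "is_glb (powerset_order X) (X \<inter> \<Inter>S) S"
  using assms by (fastforce simp: greatest_def Lower_def)

lemma complete_lattice_powerset: "complete_lattice (powerset_order X)"
proof -
  interpret partial_order "powerset_order X"
    by (rule partial_order_powerset)
  show ?thesis
    by unfold_locales
      (metis is_lub_powerset powerset_order_simps(1), metis is_glb_powerset powerset_order_simps(1))
qed

text \<open>The lattice supremum is a choice among least upper bounds, so its value is fixed by
  their uniqueness in a partial order.\<close>

lemma powerset_sup:
  assumes "S \<subseteq> Pow X"
  shows "\<Squnion>\<^bsub>powerset_order X\<^esub> S = \<Union>S"
proof -
  interpret complete_lattice "powerset_order X"
    by (rule complete_lattice_powerset)
  show ?thesis
    using is_lub_powerset[OF assms] sup_lub[of S] assms least_unique by force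
qed

lemma powerset_inf:
  assumes "S \<subseteq> Pow X"
  shows "\<Sqinter>\<^bsub>powerset_order X\<^esub> S = X \<inter> \<Inter>S"
proof -
  interpret complete_lattice "powerset_order X"
    by (rule complete_lattice_powerset)
  show ?thesis
    using is_glb_powerset[OF assms] inf_glb[of S] assms greatest_unique by force
qed

lemma powerset_join:
  "\<lbrakk>A \<subseteq> X; B \<subseteq> X\<rbrakk> \<Longrightarrow> A \<squnion>\<^bsub>powerset_order X\<^esub> B = A \<union> B"
  by (simp add: join_def powerset_sup)

lemma powerset_meet:
  "\<lbrakk>A \<subseteq> X; B \<subseteq> X\<rbrakk> \<Longrightarrow> A \<sqinter>\<^bsub>powerset_order X\<^esub> B = A \<inter> B"
  by (auto simp: meet_def powerset_inf)

lemma powerset_bottom: "\<bottom>\<^bsub>powerset_order X\<^esub> = {}"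
proof -
  interpret complete_lattice "powerset_order X"
    by (rule complete_lattice_powerset)
  show ?thesis
    using bottom_lower[of "{}"] by simp
qed

lemma powerset_top: "\<top>\<^bsub>powerset_order X\<^esub> = X"
proof -
  interpret complete_lattice "powerset_order X"
    by (rule complete_lattice_powerset)
  show ?thesis
    using top_higher[of X] top_closed by auto
qed

lemma complete_boolean_algebra_powerset: "complete_boolean_algebra (powerset_order X)"
proof -
  interpret complete_lattice "powerset_order X"
    by (rule complete_lattice_powerset)
  show ?thesis
  proof unfold_locales
    fix A B C
    assume "A \<in> carrier (powerset_order X)" "B \<in> carrier (powerset_order X)"
      "C \<in> carrier (powerset_order X)"
    \<comment> \<open>The last three inclusions are the side conditions of
      \<open>powerset_join\<close> and \<open>powerset_meet\<close> for the outer
      operations.\<close>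
    then have sub: "A \<subseteq> X" "B \<subseteq> X" "C \<subseteq> X" "B \<union> C \<subseteq> X" "A \<inter> B \<subseteq> X" "A \<inter> C \<subseteq> X"
      by auto
    show "A \<sqinter>\<^bsub>powerset_order X\<^esub> (B \<squnion>\<^bsub>powerset_order X\<^esub> C)
        = (A \<sqinter>\<^bsub>powerset_order X\<^esub> B) \<squnion>\<^bsub>powerset_order X\<^esub> (A \<sqinter>\<^bsub>powerset_order X\<^esub> C)"
      by (simp only: powerset_join powerset_meet sub Int_Un_distrib)
  next
    fix A
    assume "A \<in> carrier (powerset_order X)"
    then show "\<exists>B \<in> carrier (powerset_order X). A \<squnion>\<^bsub>powerset_order X\<^esub> B = \<top>\<^bsub>powerset_order X\<^esub>
        \<and> A \<sqinter>\<^bsub>powerset_order X\<^esub> B = \<bottom>\<^bsub>powerset_order X\<^esub>"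
      by (intro bexI[of _ "X - A"])
        (auto simp: powerset_join powerset_meet powerset_top powerset_bottom)
  qed
qed

lemma atomic_powerset: "atomic (powerset_order X)"
  unfolding atomic_def
proof (intro ballI impI)
  fix A
  assume "A \<in> carrier (powerset_order X)" "A \<noteq> \<bottom>\<^bsub>powerset_order X\<^esub>"
  then obtain x where "x \<in> A" "x \<in> X"
    by (auto simp: powerset_bottom)
  then show "\<exists>a. is_atom (powerset_order X) a \<and> a \<sqsubseteq>\<^bsub>powerset_order X\<^esub> A"
    by (intro exI[of _ "{x}"]) (auto simp: is_atom_def powerset_bottom)
qed

section \<open>The modal structure of the powerset\<close>

lemma mem_set_ext: "z \<in> set_ext m A B \<longleftrightarrow> (\<exists>a\<in>A. \<exists>b\<in>B. z \<in> m a b)"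
  by (auto simp: set_ext_def)

text \<open>Elementwise core of the export axioms: for an idempotent \<open>f\<close>, restricting
  by a condition on \<open>f x\<close> commutes with taking images under \<open>f\<close>.\<close>

lemma filter_image_eq:
  "(\<And>x. x \<in> A \<Longrightarrow> f (f x) = f x) \<Longrightarrow> {y \<in> f ` A. f y \<in> C} = f ` {x \<in> A. f x \<in> C}"
  by (auto intro: rev_image_eqI)

context lr_multimagma
begin

lemma r_eq_l: "\<lbrakk>x \<in> X; y \<in> X; z \<in> x \<odot> y\<rbrakk> \<Longrightarrow> r x = l y"
  using D_imp by (auto simp: D_def)

text \<open>Since \<open>l x \<odot> x\<close> contains \<open>x\<close>, the pair
  \<open>l x\<close>, \<open>x\<close> is composable, and \<open>D_imp\<close> for it is the claim.
  Together with the dual \<open>l_r\<close> this yields idempotence of both maps.\<close>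

lemma r_l: "x \<in> X \<Longrightarrow> r (l x) = l x"
  using r_eq_l[of "l x" x x] by (simp add: l_closed l_absorb)

lemma l_r: "x \<in> X \<Longrightarrow> l (r x) = r x"
  using r_eq_l[of x "r x" x] by (simp add: r_closed r_absorb)

lemma l_l: "x \<in> X \<Longrightarrow> l (l x) = l x"
  by (metis l_closed l_r r_l)

lemma r_r: "x \<in> X \<Longrightarrow> r (r x) = r x"
  by (metis r_closed l_r r_l)

lemma mem_unit_mult: "\<lbrakk>x \<in> X; y \<in> X\<rbrakk> \<Longrightarrow> z \<in> l y \<odot> x \<longleftrightarrow> l y = l x \<and> z = x"
  by (metis l_absorb l_closed r_eq_l r_l singleton_iff)

lemma mem_mult_unit: "\<lbrakk>x \<in> X; y \<in> X\<rbrakk> \<Longrightarrow> z \<in> x \<odot> r y \<longleftrightarrow> r y = r x \<and> z = x"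
  by (metis r_absorb r_closed r_eq_l l_r singleton_iff)

lemma set_ext_closed: "\<lbrakk>A \<subseteq> X; B \<subseteq> X\<rbrakk> \<Longrightarrow> set_ext m A B \<subseteq> X"
  using mult_closed by (fastforce simp: mem_set_ext)

text \<open>With \<open>unit_set X l\<close> written as the image of \<open>X\<close> under
  \<open>l\<close> and under \<open>r\<close>, the unit laws become instances of
  \<open>set_ext_image_l\<close> and \<open>set_ext_image_r\<close>.\<close>

lemma unit_set_eq_image_l: "unit_set X l = l ` X"
  by (auto simp: unit_set_def l_closed l_l image_iff) metis

lemma unit_set_eq_image_r: "unit_set X l = r ` X"
  by (auto simp: unit_set_def r_closed l_r image_iff) (metis r_l)

text \<open>By \<open>mem_unit_mult\<close> a unit either fixes an element or annihilates it, so a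
  set of units acts as domain restriction. Unit laws, absorption and export are read off from this
  and its dual.\<close>

lemma set_ext_image_l:
  "\<lbrakk>A \<subseteq> X; B \<subseteq> X\<rbrakk> \<Longrightarrow> set_ext m (l ` A) B = {b \<in> B. l b \<in> l ` A}"
  by (auto simp: mem_set_ext mem_unit_mult subset_iff image_iff) metis+

lemma set_ext_image_r:
  "\<lbrakk>A \<subseteq> X; B \<subseteq> X\<rbrakk> \<Longrightarrow> set_ext m A (r ` B) = {a \<in> A. r a \<in> r ` B}"
  by (auto simp: mem_set_ext mem_mult_unit subset_iff image_iff) metis+

lemma image_l_subset: "A \<subseteq> X \<Longrightarrow> l ` A \<subseteq> X"
  using l_closed by auto

lemma image_r_subset: "A \<subseteq> X \<Longrightarrow> r ` A \<subseteq> X"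
  using r_closed by auto

lemma image_r_l: "A \<subseteq> X \<Longrightarrow> r ` l ` A = l ` A"
  by (force simp: r_l image_image)

lemma image_l_r: "A \<subseteq> X \<Longrightarrow> l ` r ` A = r ` A"
  by (force simp: l_r image_image)

lemma pre_modal_powerset:
  "pre_modal (powerset_order X) (set_ext m) (unit_set X l) (\<lambda>A. l ` A) (\<lambda>A. r ` A)"
proof -
  interpret P: complete_lattice "powerset_order X"
    by (rule complete_lattice_powerset)
  show ?thesis
  proof (unfold_locales, unfold powerset_order_simps Pow_iff powerset_bottom)
    show "unit_set X l \<subseteq> X"
      by (auto simp: unit_set_def)
    fix A
    assume A: "A \<subseteq> X"
    show "set_ext m (unit_set X l) A = A" "set_ext m A (unit_set X l) = A"
      using A set_ext_image_l[OF subset_refl A] set_ext_image_r[OF A subset_refl]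
      by (auto simp flip: unit_set_eq_image_l unit_set_eq_image_r
          simp: unit_set_def l_l l_r l_closed r_closed subset_iff)
    show "l ` A \<subseteq> X" "r ` A \<subseteq> X"
      using A by (simp_all add: image_l_subset image_r_subset)
    show "A \<subseteq> set_ext m (l ` A) A" "A \<subseteq> set_ext m A (r ` A)"
      using A by (auto simp: set_ext_image_l set_ext_image_r)
    show "l ` A \<subseteq> unit_set X l" "r ` A \<subseteq> unit_set X l"
      using A by (auto simp: unit_set_def l_closed r_closed l_l l_r)
    show "l ` r ` A = r ` A" "r ` l ` A = l ` A"
      using A by (simp_all add: image_l_r image_r_l)
    fix B
    assume B: "B \<subseteq> X"
    show "set_ext m A B \<subseteq> X"
      by (rule set_ext_closed[OF A B])
    show "l ` (A \<squnion>\<^bsub>powerset_order X\<^esub> B) = l ` A \<squnion>\<^bsub>powerset_order X\<^esub> l ` B"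
      "r ` (A \<squnion>\<^bsub>powerset_order X\<^esub> B) = r ` A \<squnion>\<^bsub>powerset_order X\<^esub> r ` B"
      using A B by (simp_all add: powerset_join image_l_subset image_r_subset image_Un)
  next
    fix A S
    assume A: "A \<subseteq> X" and S: "S \<subseteq> Pow X"
    \<comment> \<open>\<open>powerset_sup\<close> evaluates suprema only for families of subsets of
      \<open>X\<close>, so the families of products are checked first.\<close>
    have "set_ext m A ` S \<subseteq> Pow X" "(\<lambda>B. set_ext m B A) ` S \<subseteq> Pow X"
      using A S set_ext_closed by blast+
    then show "set_ext m A (\<Squnion>\<^bsub>powerset_order X\<^esub> S) = \<Squnion>\<^bsub>powerset_order X\<^esub> (set_ext m A ` S)"
      "set_ext m (\<Squnion>\<^bsub>powerset_order X\<^esub> S) A = \<Squnion>\<^bsub>powerset_order X\<^esub> ((\<lambda>B. set_ext m B A) ` S)"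
      using S by (simp_all add: powerset_sup) (simp_all add: set_ext_def, blast+)
  \<comment> \<open>The bottom laws remain: images of the empty set are empty.\<close>
  qed simp_all
qed

lemma modal_prequantale_powerset:
  "modal_prequantale (powerset_order X) (set_ext m) (unit_set X l) (\<lambda>A. l ` A) (\<lambda>A. r ` A)"
proof -
  interpret P: pre_modal "powerset_order X" "set_ext m" "unit_set X l" "\<lambda>A. l ` A" "\<lambda>A. r ` A"
    by (rule pre_modal_powerset)
  show ?thesis
  proof (unfold_locales, unfold powerset_order_simps Pow_iff)
    fix A B
    assume A: "A \<subseteq> X" and B: "B \<subseteq> X"
    show "l ` set_ext m (l ` A) B = set_ext m (l ` A) (l ` B)"
      \<comment> \<open>Both sides restrict by the image of \<open>A\<close> under \<open>l\<close>,
        one before and one after applying \<open>l\<close> to \<open>B\<close>.\<close>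
      unfolding set_ext_image_l[OF A B] set_ext_image_l[OF A image_l_subset[OF B]]
      using l_l[OF subsetD[OF B]] by (simp add: filter_image_eq)
    show "r ` set_ext m A (r ` B) = set_ext m (r ` A) (r ` B)"
      unfolding set_ext_image_r[OF A B] set_ext_image_r[OF image_r_subset[OF A] B]
      using r_r[OF subsetD[OF A]] by (simp add: filter_image_eq)
  qed
qed

lemma boolean_modal_prequantale_powerset:
  "boolean_modal_prequantale (powerset_order X) (set_ext m) (unit_set X l)
     (\<lambda>A. l ` A) (\<lambda>A. r ` A)"
  by (intro boolean_modal_prequantale.intro modal_prequantale_powerset
      complete_boolean_algebra_powerset)

end

section \<open>Associativity, and the values of \<open>l\<close> and \<open>r\<close> on
  products\<close>

context lr_multisemigroup
begin

text \<open>The elementwise form can be applied under the bounded quantifiers of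
  \<open>set_ext_assoc\<close> and exposes the intermediate element \<open>u\<close>.\<close>

lemma assoc_mem:
  assumes "x \<in> X" "y \<in> X" "z \<in> X"
  shows "(\<exists>u\<in>m y z. w \<in> m x u) \<longleftrightarrow> (\<exists>u\<in>m x y. w \<in> m u z)"
  using arg_cong[OF assoc[OF assms], of "\<lambda>S. w \<in> S"] by (simp add: mem_set_ext)

lemma set_ext_assoc:
  assumes "A \<subseteq> X" "B \<subseteq> X" "C \<subseteq> X"
  shows "set_ext m (set_ext m A B) C = set_ext m A (set_ext m B C)"
proof (rule Set.set_eqI)
  fix w
  have "w \<in> set_ext m (set_ext m A B) C
      \<longleftrightarrow> (\<exists>a\<in>A. \<exists>b\<in>B. \<exists>c\<in>C. \<exists>u\<in>m a b. w \<in> m u c)"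
    unfolding mem_set_ext Bex_def by blast
  also have "\<dots> \<longleftrightarrow> (\<exists>a\<in>A. \<exists>b\<in>B. \<exists>c\<in>C. \<exists>u\<in>m b c. w \<in> m a u)"
    using assms by (intro bex_cong refl assoc_mem[symmetric]) auto
  also have "\<dots> \<longleftrightarrow> w \<in> set_ext m A (set_ext m B C)"
    unfolding mem_set_ext Bex_def by blast
  finally show "w \<in> set_ext m (set_ext m A B) C \<longleftrightarrow> w \<in> set_ext m A (set_ext m B C)" .
qed

lemma l_mult:
  assumes "x \<in> X" "y \<in> X" "z \<in> m x y"
  shows "l z = l x"
proof -
  \<comment> \<open>As \<open>l x \<odot> x = {x}\<close>, one bracketing of \<open>l x\<close>,
    \<open>x\<close>, \<open>y\<close> contains \<open>z\<close>; the other one gives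
    \<open>u\<close>. By \<open>mem_unit_mult\<close>, \<open>l x = l u\<close> and
    \<open>z = u\<close>.\<close>
  obtain u where "u \<in> m x y" "z \<in> m (l x) u"
    using assoc_mem[of "l x" x y z] assms by (auto simp: l_closed l_absorb)
  then show ?thesis
    using assms mult_closed by (metis mem_unit_mult subsetD)
qed

lemma r_mult:
  assumes "x \<in> X" "y \<in> X" "z \<in> m x y"
  shows "r z = r y"
proof -
  obtain u where "u \<in> m x y" "z \<in> m u (r y)"
    using assoc_mem[of x y "r y" z] assms by (auto simp: r_closed r_absorb)
  then show ?thesis
    using assms mult_closed by (metis mem_mult_unit subsetD)
qed

lemma weakly_local_modal_quantale_powerset:
  "weakly_local_modal_quantale (powerset_order X) (set_ext m) (unit_set X l)
     (\<lambda>A. l ` A) (\<lambda>A. r ` A)"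
  by (intro weakly_local_modal_quantale.intro weakly_local_modal_quantale_axioms.intro
      modal_prequantale_powerset) (simp add: set_ext_assoc)

end

section \<open>Locality of domain and codomain\<close>

context local_lr_multisemigroup
begin

text \<open>A product of \<open>a\<close> and \<open>b\<close> can contribute only the value
  \<open>l a\<close>, and does so exactly when \<open>r a = l b\<close>. The resulting formula sees
  \<open>B\<close> only through its image under \<open>l\<close>, which is what
  \<open>dom_local\<close> asks for.\<close>

lemma image_l_set_ext:
  assumes A: "A \<subseteq> X" and B: "B \<subseteq> X"
  shows "l ` set_ext m A B = l ` {a \<in> A. r a \<in> l ` B}"
proof
  show "l ` set_ext m A B \<subseteq> l ` {a \<in> A. r a \<in> l ` B}"
  proof clarify
    fix z
    assume "z \<in> set_ext m A B"
    then obtain a b where *: "a \<in> A" "b \<in> B" "z \<in> m a b"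
      by (auto simp: mem_set_ext)
    moreover have "l z = l a" "r a = l b"
      using * A B l_mult r_eq_l by (blast, metis subsetD)
    ultimately show "l z \<in> l ` {a \<in> A. r a \<in> l ` B}"
      by auto
  qed
next
  show "l ` {a \<in> A. r a \<in> l ` B} \<subseteq> l ` set_ext m A B"
  proof clarify
    fix a b
    assume *: "a \<in> A" "r a = l b" "b \<in> B"
    \<comment> \<open>Locality supplies an element of the product, and by \<open>l_mult\<close> its
      image under \<open>l\<close> is \<open>l a\<close>.\<close>
    then obtain z where "z \<in> m a b"
      using A B locality[of a b] by (auto simp: D_def)
    moreover have "l z = l a"
      using * A B calculation l_mult by blast
    ultimately show "l a \<in> l ` set_ext m A B"
      using * by (metis mem_set_ext imageI)
  qed
qed

lemma image_r_set_ext: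
  assumes A: "A \<subseteq> X" and B: "B \<subseteq> X"
  shows "r ` set_ext m A B = r ` {b \<in> B. l b \<in> r ` A}"
proof
  show "r ` set_ext m A B \<subseteq> r ` {b \<in> B. l b \<in> r ` A}"
  proof clarify
    fix z
    assume "z \<in> set_ext m A B"
    then obtain a b where *: "a \<in> A" "b \<in> B" "z \<in> m a b"
      by (auto simp: mem_set_ext)
    moreover have "r z = r b" "l b = r a"
      using * A B r_mult r_eq_l by (blast, metis subsetD)
    ultimately show "r z \<in> r ` {b \<in> B. l b \<in> r ` A}"
      by auto
  qed
next
  show "r ` {b \<in> B. l b \<in> r ` A} \<subseteq> r ` set_ext m A B"
  proof clarify
    fix a b
    assume *: "b \<in> B" "l b = r a" "a \<in> A"
    then obtain z where "z \<in> m a b"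
      using A B locality[of a b] by (auto simp: D_def)
    moreover have "r z = r b"
      using * A B calculation r_mult by blast
    ultimately show "r b \<in> r ` set_ext m A B"
      using * by (metis mem_set_ext imageI)
  qed
qed

lemma modal_quantale_powerset:
  "modal_quantale (powerset_order X) (set_ext m) (unit_set X l) (\<lambda>A. l ` A) (\<lambda>A. r ` A)"
proof -
  \<comment> \<open>Idempotence on sets makes the two sides of each locality axiom coincide after
    rewriting with \<open>image_l_set_ext\<close> and \<open>image_r_set_ext\<close>.\<close>
  have "l ` l ` A = l ` A" "r ` r ` A = r ` A" if "A \<subseteq> X" for A
    using that by (force simp: l_l r_r image_image)+
  then show ?thesis
    by (intro modal_quantale.intro modal_quantale_axioms.intro pre_modal_powerset)
      (simp_all add: set_ext_assoc image_l_set_ext image_r_set_ext image_l_subset image_r_subset)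
qed

end

theorem theorem6p4:
  fixes X :: "'a set"
    and m :: "'a \<Rightarrow> 'a \<Rightarrow> 'a set"
    and l r :: "'a \<Rightarrow> 'a"
  assumes "lr_multimagma X m l r"
  shows "(boolean_modal_prequantale (powerset_order X) (set_ext m) (unit_set X l)
            (\<lambda>A. l ` A) (\<lambda>A. r ` A)
          \<and> atomic (powerset_order X))
       \<and> (lr_multisemigroup X m l r \<longrightarrow>
          weakly_local_modal_quantale (powerset_order X) (set_ext m) (unit_set X l)
            (\<lambda>A. l ` A) (\<lambda>A. r ` A))
       \<and> (local_lr_multisemigroup X m l r \<longrightarrow>
          modal_quantale (powerset_order X) (set_ext m) (unit_set X l)
            (\<lambda>A. l ` A) (\<lambda>A. r ` A))"
  using assms
  by (intro conjI impI lr_multimagma.boolean_modal_prequantale_powerset atomic_powerset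
      lr_multisemigroup.weakly_local_modal_quantale_powerset
      local_lr_multisemigroup.modal_quantale_powerset)

end
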